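(* For all real or complex numbers $p$ and $x$, $$M(x,p)=E(x,p)+e^x\int_0^x e^{-t}E(t,p)\,dt,$$ where $$M(x,p)=\sum_{n=1}^{\infty}\left(1^p+2^p+\dots+n^p\right)\frac{x^n}{n!},\qquad E(x,p)=\sum_{n=1}^{\infty}\frac{n^p x^n}{n!}.$$
   Context: For a positive integer $n$ and a complex number $p$, $n^p=e^{p\ln n}$. Both series converge for every complex $x$ and define entire functions of $x$. For complex $x$ the integral is taken along the line segment from $0$ to $x$. *)

theory Defs
  imports "HOL-Complex_Analysis.Complex_Analysis"
begin

text \<open>
  Both series start at index 1, hence the shift to \<open>Suc n\<close>.  For a positive natural number
  \<open>k\<close>, \<open>of_nat k powr p = exp (p * Ln (of_nat k))\<close> with the principal logarithm, which is real
  here; see \<open>of_nat_powr_eq\<close> below.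
\<close>

definition E :: "complex \<Rightarrow> complex \<Rightarrow> complex" where
  "E x p = (\<Sum>n. of_nat (Suc n) powr p * x ^ Suc n / fact (Suc n))"

definition M :: "complex \<Rightarrow> complex \<Rightarrow> complex" where
  "M x p = (\<Sum>n. (\<Sum>k=1..Suc n. of_nat k powr p) * x ^ Suc n / fact (Suc n))"

lemma of_nat_powr_eq:
  assumes "k > 0"
  shows "(of_nat k :: complex) powr p = exp (p * of_real (ln (real k)))"
  using assms Ln_of_nat[of k] by (simp add: powr_def Ln_of_nat)

lemma norm_of_nat_powr_le:
  assumes "0 < k" "k \<le> n"
  shows "norm ((of_nat k :: complex) powr p) \<le> real n ^ nat \<lceil>\<bar>Re p\<bar>\<rceil>"
proof -
  have "norm ((of_nat k :: complex) powr p) = real k powr Re p"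
    using assms by (simp add: of_nat_powr_eq powr_def)
  also have "\<dots> \<le> real k powr real (nat \<lceil>\<bar>Re p\<bar>\<rceil>)"
    using assms by (intro powr_mono) linarith+
  also have "\<dots> = real k ^ nat \<lceil>\<bar>Re p\<bar>\<rceil>"
    using assms by (intro powr_realpow) simp
  also have "\<dots> \<le> real n ^ nat \<lceil>\<bar>Re p\<bar>\<rceil>"
    using assms by (intro power_mono) auto
  finally show ?thesis .
qed

lemma power_le_fact_exp:
  fixes y :: real
  assumes "y \<ge> 0"
  shows "y ^ m \<le> fact m * exp y"
proof -
  have "(\<lambda>n. y ^ n / fact n) sums exp y"
    using exp_converges[of y] by (simp add: field_simps)
  hence "sum (\<lambda>n. y ^ n / fact n) {m} \<le> exp y"
    using assms sum_le_suminf[of "\<lambda>n. y ^ n / fact n" "{m}"] by (auto simp: sums_iff)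
  thus ?thesis by (simp add: field_simps)
qed

lemma summable_polynomial_growth:
  fixes c :: "nat \<Rightarrow> complex"
  assumes "\<And>n. norm (c (Suc n)) \<le> real (Suc n) ^ m"
  shows "summable (\<lambda>n. c (Suc n) * x ^ Suc n / fact (Suc n))"
proof (rule summable_comparison_test)
  let ?g = "\<lambda>n. fact m * ((exp 1 * norm x) ^ n / fact n) :: real"
  have "summable ?g"
    using summable_exp[of "exp 1 * norm x"] by (intro summable_mult) (simp add: field_simps)
  thus "summable (\<lambda>n. ?g (Suc n))"
    by (subst summable_Suc_iff)
  have "norm (c (Suc n) * x ^ Suc n / fact (Suc n)) \<le> ?g (Suc n)" for n
  proof -
    have "norm (c (Suc n)) \<le> fact m * exp (real (Suc n))"
      using assms power_le_fact_exp[of "real (Suc n)" m] by (meson of_nat_0_le_iff order_trans)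
    also have "exp (real (Suc n)) = exp 1 ^ Suc n"
      by (metis exp_of_nat_mult mult.right_neutral)
    finally have "norm (c (Suc n)) * (norm x ^ Suc n / fact (Suc n))
        \<le> fact m * exp 1 ^ Suc n * (norm x ^ Suc n / fact (Suc n))"
      by (intro mult_right_mono) auto
    thus ?thesis
      by (simp only: norm_mult norm_divide norm_power norm_fact power_mult_distrib times_divide_eq_right
          mult.assoc)
  qed
  thus "\<exists>N. \<forall>n\<ge>N. norm (c (Suc n) * x ^ Suc n / fact (Suc n)) \<le> ?g (Suc n)"
    by blast
qed

lemma summable_E: "summable (\<lambda>n. of_nat (Suc n) powr p * x ^ Suc n / fact (Suc n) :: complex)"
  using summable_polynomial_growth[of "\<lambda>n. of_nat n powr p"] norm_of_nat_powr_le[of _ _ p]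
  by blast

lemma summable_M:
  "summable (\<lambda>n. (\<Sum>k=1..Suc n. of_nat k powr p) * x ^ Suc n / fact (Suc n) :: complex)"
proof (rule summable_polynomial_growth[of "\<lambda>n. \<Sum>k=1..n. of_nat k powr p"])
  fix n
  have "norm (\<Sum>k=1..Suc n. (of_nat k :: complex) powr p)
      \<le> (\<Sum>k=1..Suc n. real (Suc n) ^ nat \<lceil>\<bar>Re p\<bar>\<rceil>)"
    by (intro order_trans[OF norm_sum] sum_mono norm_of_nat_powr_le) auto
  thus "norm (\<Sum>k=1..Suc n. (of_nat k :: complex) powr p)
      \<le> real (Suc n) ^ Suc (nat \<lceil>\<bar>Re p\<bar>\<rceil>)"
    by simp
qed

end

theory Submission
  imports Defs
begin

text \<open>
  Comparing coefficients gives \<open>M' - E' = M\<close>, so \<open>exp (- t) * E t p\<close> is the derivative of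
  \<open>exp (- t) * (M t p - E t p)\<close>, which vanishes at \<open>t = 0\<close>.
\<close>

text \<open>The index can start at 0 because \<open>0 powr p = 0\<close> for every \<open>p\<close>.\<close>

lemma E_sums: "(\<lambda>n. of_nat n powr p / fact n * x ^ n) sums E x p"
proof -
  have "(\<lambda>n. of_nat (Suc n) powr p / fact (Suc n) * x ^ Suc n) sums E x p"
    using summable_sums[OF summable_E[of p x]] unfolding E_def by simp
  from sums_Suc[OF this] show ?thesis
    by simp
qed

text \<open>The term added at index 0 is an empty sum.\<close>

lemma M_sums: "(\<lambda>n. (\<Sum>k=1..n. of_nat k powr p) / fact n * x ^ n) sums M x p"
proof -
  have "(\<lambda>n. (\<Sum>k=1..Suc n. of_nat k powr p) / fact (Suc n) * x ^ Suc n) sums M x p"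
    using summable_sums[OF summable_M[of p x]] unfolding M_def by simp
  from sums_Suc[OF this] show ?thesis
    by simp
qed

text \<open>Differentiating an exponential generating function shifts its coefficients, as
  \<open>Suc n / fact (Suc n) = 1 / fact n\<close>.\<close>

lemma diffs_divide_fact:
  "diffs (\<lambda>n. f n / fact n) = (\<lambda>n. f (Suc n) / fact n :: 'a::real_normed_field)"
  by (simp add: diffs_def fun_eq_iff divide_simps del: of_nat_Suc)

lemma M_minus_E_has_field_derivative:
  "((\<lambda>x. M x p - E x p) has_field_derivative M x p) (at x)"
proof -
  define d :: "nat \<Rightarrow> complex"
    where "d = (\<lambda>n. ((\<Sum>k=1..n. of_nat k powr p) - of_nat n powr p) / fact n)"
  have d_sums: "(\<lambda>n. d n * y ^ n) sums (M y p - E y p)" for y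
    using sums_diff[OF M_sums[of p y] E_sums[of p y]]
    by (simp add: d_def diff_divide_distrib left_diff_distrib)
  \<comment> \<open>In \<open>d (Suc n)\<close> the subtraction cancels the last summand
    \<open>k = Suc n\<close>, leaving the sum up to \<open>n\<close>, which is the numerator in
    \<open>M\<close> at index \<open>n\<close>.\<close>
  have "diffs d = (\<lambda>n. (\<Sum>k=1..n. of_nat k powr p) / fact n)"
    by (simp add: d_def diffs_divide_fact)
  then have "(\<Sum>n. diffs d n * x ^ n) = M x p"
    using M_sums[of p x] by (simp add: sums_iff)
  moreover have "((\<lambda>y. \<Sum>n. d n * y ^ n) has_field_derivative (\<Sum>n. diffs d n * x ^ n)) (at x)"
    using d_sums by (intro termdiffs_strong_converges_everywhere) (auto simp: sums_iff)
  moreover have "(\<lambda>y. \<Sum>n. d n * y ^ n) = (\<lambda>y. M y p - E y p)"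
    using d_sums by (simp add: sums_iff)
  ultimately show ?thesis
    by simp
qed

theorem proposition1:
  fixes p x :: complex
  shows "M x p = E x p + exp x * contour_integral (linepath 0 x) (\<lambda>t. exp (- t) * E t p)"
proof -
  define G where "G = (\<lambda>t. exp (- t) * (M t p - E t p))"
  have "(G has_field_derivative exp (- t) * E t p) (at t)" for t
    unfolding G_def
    \<comment> \<open>The product rule gives
      \<open>exp (- t) * M t p - exp (- t) * (M t p - E t p)\<close>, where the \<open>M\<close>
      terms cancel.\<close>
    by (rule derivative_eq_intros M_minus_E_has_field_derivative refl)+ (simp add: algebra_simps)
  then have "((\<lambda>t. exp (- t) * E t p) has_contour_integral G x - G 0) (linepath 0 x)"
    using contour_integral_primitive[of UNIV G "\<lambda>t. exp (- t) * E t p" "linepath 0 x"] by simp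
  then have "contour_integral (linepath 0 x) (\<lambda>t. exp (- t) * E t p) = G x - G 0"
    by (rule contour_integral_unique)
  moreover have "G 0 = 0"
    by (simp add: G_def M_def E_def)
  ultimately show ?thesis
    by (simp add: G_def exp_minus field_simps)
qed

end
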